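(* Let $\alpha,\gamma,\kappa>-1$ be real numbers with $\alpha+\kappa>-\frac32$, and let $f(x,y)$ and $g(x,y)$ be symmetric polynomials. Then $\mathcal{D}_{1}^{\alpha,\gamma,\kappa}$ is formally self-adjoint with respect to $w_{\alpha,\gamma,\kappa}$ on $\triangle$, that is, \[ \int_{\triangle}\mathcal{D}_{1}^{\alpha,\gamma,\kappa}[f(x,y)]\,g(x,y)\,w_{\alpha,\gamma,\kappa}(x,y)\,dx\,dy=\int_{\triangle}f(x,y)\,\mathcal{D}_{1}^{\alpha,\gamma,\kappa}[g(x,y)]\,w_{\alpha,\gamma,\kappa}(x,y)\,dx\,dy . \]
   Context: All polynomials have real coefficients. A polynomial in $x,y$ is called symmetric if it is invariant under interchange of $x$ and $y$. Let $\mathbf{T}^2=\{(x,y)\in\mathbb{R}^2:\ x\ge0,\ y\ge0,\ x+y\le1\}$, $\triangle=\{(x,y)\in\mathbf{T}^2:\ y<x\}$, and \[ w_{\alpha,\gamma,\kappa}(x,y)=(xy)^{\alpha}(1-x-y)^{\gamma}|x-y|^{2\kappa+1}. \] With $z=1-x-y$ and $\partial_z:=\partial_y-\partial_x$, define \[ \mathcal{D}_{1}^{\alpha,\gamma,\kappa}:=\frac{1}{w_{\alpha,\gamma,\kappa}}\Bigl[\partial_x\bigl(xz\,w_{\alpha,\gamma,\kappa}\,\partial_x\bigr)+\partial_y\bigl(yz\,w_{\alpha,\gamma,\kappa}\,\partial_y\bigr)+\partial_z\bigl(xy\,w_{\alpha,\gamma,\kappa}\,\partial_z\bigr)\Bigr],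 \] which, when expanded, is \[ \begin{aligned} \mathcal{D}_{1}^{\alpha,\gamma,\kappa}&=x(1-x)\partial_x^2-2xy\,\partial_x\partial_y+y(1-y)\partial_y^2\\ &\quad+\left[\alpha+1-(2\alpha+\gamma+2\kappa+4)x\right]\partial_x+\left[\alpha+1-(2\alpha+\gamma+2\kappa+4)y\right]\partial_y\\ &\quad+(2\kappa+1)\frac{x\partial_x-y\partial_y}{x-y}. \end{aligned} \] When applied to a symmetric polynomial $p$, the numerator $x\partial_xp-y\partial_yp$ is divisible by $x-y$, so $\mathcal{D}_{1}^{\alpha,\gamma,\kappa}p$ is a polynomial. *)

theory Defs
  imports "HOL-Analysis.Analysis"
begin

definition simplex2 :: "(real \<times> real) set" where
  "simplex2 = {(x, y). x \<ge> 0 \<and> y \<ge> 0 \<and> x + y \<le> 1}"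

definition lower_triangle :: "(real \<times> real) set" where
  "lower_triangle = {(x, y) \<in> simplex2. y < x}"

definition weight :: "real \<Rightarrow> real \<Rightarrow> real \<Rightarrow> real \<times> real \<Rightarrow> real" where
  "weight \<alpha> \<gamma> \<kappa> = (\<lambda>(x, y).
     (x * y) powr \<alpha> * (1 - x - y) powr \<gamma> * \<bar>x - y\<bar> powr (2 * \<kappa> + 1))"

definition dx :: "(real \<times> real \<Rightarrow> real) \<Rightarrow> real \<times> real \<Rightarrow> real" where
  "dx F = (\<lambda>(x, y). deriv (\<lambda>t. F (t, y)) x)"

definition dy :: "(real \<times> real \<Rightarrow> real) \<Rightarrow> real \<times> real \<Rightarrow> real" where
  "dy F = (\<lambda>(x, y). deriv (\<lambda>t. F (x, t)) y)"

text \<open>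
  Here \<open>z\<close> is not an independent third variable: \<open>dz\<close> is the operator \<open>dy - dx\<close>.
\<close>

definition dz :: "(real \<times> real \<Rightarrow> real) \<Rightarrow> real \<times> real \<Rightarrow> real" where
  "dz F = (\<lambda>p. dy F p - dx F p)"

text \<open>
  On the interior of \<open>lower_triangle\<close> the weight is positive and smooth, so for a polynomial \<open>f\<close> all
  derivatives below exist. On the two edges \<open>y = 0\<close> and \<open>x + y = 1\<close> contained in \<open>lower_triangle\<close>,
  a null set, the convention \<open>0 powr a = 0\<close> makes the weight zero for every exponent, and hence
  also \<open>D1 \<alpha> \<gamma> \<kappa> f\<close>, because \<open>1 / 0 = 0\<close>.
\<close>

definition D1 :: "real \<Rightarrow> real \<Rightarrow> real \<Rightarrow> (real \<times> real \<Rightarrow> real) \<Rightarrow> real \<times> real \<Rightarrow> real" where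
  "D1 \<alpha> \<gamma> \<kappa> f = (\<lambda>p. 1 / weight \<alpha> \<gamma> \<kappa> p *
     (dx (\<lambda>(x, y). x * (1 - x - y) * weight \<alpha> \<gamma> \<kappa> (x, y) * dx f (x, y)) p
    + dy (\<lambda>(x, y). y * (1 - x - y) * weight \<alpha> \<gamma> \<kappa> (x, y) * dy f (x, y)) p
    + dz (\<lambda>(x, y). x * y * weight \<alpha> \<gamma> \<kappa> (x, y) * dz f (x, y)) p))"

text \<open>
  Polynomials in two real variables are rendered as polynomial functions on the plane; the two
  notions coincide since the field of real numbers is infinite.
\<close>

definition symmetric_polynomial :: "(real \<times> real \<Rightarrow> real) \<Rightarrow> bool" where
  "symmetric_polynomial f \<longleftrightarrow>
     real_polynomial_function f \<and> (\<forall>x y. f (x, y) = f (y, x))"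

end

theory Submission
  imports Defs
begin

text \<open>
  In the coordinates \<open>x = u(1 + t)/2\<close>, \<open>y = u(1 - t)/2\<close> the triangle becomes the unit square, and the
  weight together with the Jacobian splits into a product \<open>\<rho>(u) \<tau>(t)\<close> with
  \<open>\<rho>(u) = u\<^sup>a (1 - u)\<^sup>\<gamma>\<close>, \<open>a = 2\<alpha> + 2\<kappa> + 2\<close>, and \<open>\<tau>(t) = (1 - t\<^sup>2)\<^sup>\<alpha> t\<^sup>k\<close>, \<open>k = 2\<kappa> + 1\<close>. The
  hypotheses on the parameters say exactly that \<open>\<rho>\<close> and \<open>\<tau>\<close> are integrable. The operator separates:
  \[ D_1 = \rho^{-1} \partial_u\, u (1 - u) \rho\, \partial_u
     + u^{-1} \tau^{-1} \partial_t\, (1 - t^2) \tau\, \partial_t . \]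
  For symmetric \<open>f\<close> the derivative \<open>\<partial>\<^sub>t f\<close> is \<open>u t\<close> times a polynomial, which removes the singular
  factors, so that each of the two summands can be integrated by parts along lines without boundary
  terms. In the original coordinates the \<open>x\<close>- and \<open>y\<close>-derivatives of the flux are not separately
  integrable near \<open>x = y\<close> when \<open>\<kappa> \<le> -1/2\<close>.
\<close>

section \<open>Coordinates adapted to the triangle\<close>

text \<open>Collapsed coordinates: \<open>u = x + y\<close> and
  \<open>t = (x - y) / (x + y)\<close>, so that \<open>t\<close> is constant along rays from the
  origin and \<open>u\<close> along segments parallel to the hypotenuse. The line
  \<open>u = 0\<close> collapses to the origin.\<close>

definition polar :: "real \<times> real \<Rightarrow> real \<times> real" where
  "polar = (\<lambda>(u, t). (u * (1 + t) / 2, u * (1 - t) / 2))"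

lemma measurable_fst_real2 [measurable]: "(fst :: real \<times> real \<Rightarrow> real) \<in> borel_measurable borel"
  and measurable_snd_real2 [measurable]: "(snd :: real \<times> real \<Rightarrow> real) \<in> borel_measurable borel"
  by (simp_all add: borel_measurable_continuous_onI continuous_on_fst continuous_on_snd continuous_on_id)

lemma measurable_polar [measurable]: "polar \<in> borel_measurable borel"
proof -
  have "(\<lambda>p. (fst p * (1 + snd p) / 2, fst p * (1 - snd p) / 2)) \<in> borel_measurable (borel :: (real \<times> real) measure)"
    by (intro borel_measurable_continuous_onI continuous_intros) auto
  then show ?thesis by (simp add: polar_def split_def)
qed

text \<open>The plane change of variables is split by Tonelli into two affine substitutions in one
  variable: the shift \<open>x = u - y\<close>, then, for fixed \<open>u\<close>, the scaling of
  \<open>y\<close> to \<open>t\<close>, which yields the Jacobian.\<close>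

lemma nn_integral_polar:
  assumes [measurable]: "H \<in> borel_measurable (borel :: (real \<times> real) measure)"
  shows "(\<integral>\<^sup>+p. H p \<partial>lborel) = (\<integral>\<^sup>+q. ennreal (\<bar>fst q\<bar> / 2) * H (polar q) \<partial>lborel)"
proof -
  have bm: "(\<lambda>(u, y). H (u - y, y)) \<in> borel_measurable (lborel \<Otimes>\<^sub>M lborel)"
    by measurable
  have bp: "(\<lambda>q. ennreal (\<bar>fst q\<bar> / 2) * H (polar q)) \<in> borel_measurable (lborel \<Otimes>\<^sub>M lborel)"
    unfolding lborel_prod by measurable
  \<comment> \<open>The substitution is \<open>y = u / 2 - (u / 2) * t\<close>, which gives
    \<open>u - y = u * (1 + t) / 2\<close>.\<close>
  have fib: "(\<integral>\<^sup>+y. H (u - y, y) \<partial>lborel) = (\<integral>\<^sup>+t. ennreal (\<bar>u\<bar> / 2) * H (polar (u, t)) \<partial>lborel)"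
    if "u \<noteq> 0" for u
    using that
    by (subst nn_integral_real_affine[where c = "- u / 2" and t = "u / 2"])
      (auto simp: polar_def nn_integral_cmult[symmetric] algebra_simps diff_divide_distrib add_divide_distrib intro!: nn_integral_cong)
  have "(\<integral>\<^sup>+p. H p \<partial>lborel) = (\<integral>\<^sup>+y. \<integral>\<^sup>+x. H (x, y) \<partial>lborel \<partial>lborel)"
    by (simp add: lborel_pair.nn_integral_snd lborel_prod)
  also have "\<dots> = (\<integral>\<^sup>+y. \<integral>\<^sup>+u. H (u - y, y) \<partial>lborel \<partial>lborel)"
    by (rule nn_integral_cong, subst nn_integral_real_affine[where c = 1 and t = "- y" for y])
       (auto simp: algebra_simps)
  also have "\<dots> = (\<integral>\<^sup>+u. \<integral>\<^sup>+y. H (u - y, y) \<partial>lborel \<partial>lborel)"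
    using lborel_pair.Fubini'[OF bm] .
  \<comment> \<open>The scaling degenerates at \<open>u = 0\<close>, a single point and hence a null
    set.\<close>
  also have "\<dots> = (\<integral>\<^sup>+u. \<integral>\<^sup>+t. ennreal (\<bar>u\<bar> / 2) * H (polar (u, t)) \<partial>lborel \<partial>lborel)"
    by (rule nn_integral_cong_AE, rule AE_mp[OF AE_lborel_singleton[of 0]]) (auto simp: fib)
  also have "\<dots> = (\<integral>\<^sup>+q. ennreal (\<bar>fst q\<bar> / 2) * H (polar q) \<partial>lborel)"
    using lborel.nn_integral_fst[OF bp] by (simp add: lborel_prod)
  finally show ?thesis .
qed

text \<open>Stated between measures, so that the transfer rules for \<open>distr\<close> and
  \<open>density\<close> yield both integrability and the Bochner integral.\<close>

lemma lborel_eq_distr_polar: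
  "(lborel :: (real \<times> real) measure) =
     distr (density lborel (\<lambda>q. ennreal (\<bar>fst q\<bar> / 2))) lborel polar"
proof (rule measure_eqI)
  fix S assume "S \<in> sets (lborel :: (real \<times> real) measure)"
  then have [measurable]: "S \<in> sets borel" by simp
  have "emeasure lborel S = (\<integral>\<^sup>+p. indicator S p \<partial>lborel)" by simp
  also have "\<dots> = (\<integral>\<^sup>+q. ennreal (\<bar>fst q\<bar> / 2) * indicator S (polar q) \<partial>lborel)"
    by (rule nn_integral_polar) measurable
  also have "\<dots> = emeasure (distr (density lborel (\<lambda>q. ennreal (\<bar>fst q\<bar> / 2))) lborel polar) S"
    by (subst emeasure_distr; (subst emeasure_density)?)
       (auto simp: indicator_def measurable_sets_borel[OF measurable_polar] intro!: nn_integral_cong)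
  finally show "emeasure lborel S = \<dots>" .
qed simp

lemma
  fixes h :: "real \<times> real \<Rightarrow> real"
  assumes [measurable]: "h \<in> borel_measurable borel"
  shows integrable_polar: "integrable lborel h \<longleftrightarrow> integrable lborel (\<lambda>q. \<bar>fst q\<bar> / 2 * h (polar q))"
    and integral_polar: "(LINT p|lborel. h p) = (LINT q|lborel. \<bar>fst q\<bar> / 2 * h (polar q))"
proof -
  show "integrable lborel h \<longleftrightarrow> integrable lborel (\<lambda>q. \<bar>fst q\<bar> / 2 * h (polar q))"
    by (subst lborel_eq_distr_polar, subst integrable_distr_eq, measurable, subst integrable_density) auto
  show "(LINT p|lborel. h p) = (LINT q|lborel. \<bar>fst q\<bar> / 2 * h (polar q))"
    by (subst lborel_eq_distr_polar, subst integral_distr, measurable, subst integral_density) auto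
qed

section \<open>Polynomial functions of two variables\<close>

text \<open>Induction on the generation of polynomial functions by sums and products. The partials
  are again polynomial, so the lemma can be iterated for second derivatives, and the total
  derivative is available for the chain rule along the curves of \<open>polar\<close>.\<close>

lemma real_polynomial_function_partials:
  fixes f :: "real \<times> real \<Rightarrow> real"
  assumes "real_polynomial_function f"
  obtains fx fy where "real_polynomial_function fx" "real_polynomial_function fy"
    "\<And>p. (f has_derivative (\<lambda>v. fx p * fst v + fy p * snd v)) (at p)"
  using assms
proof (induction arbitrary: thesis)
  case (linear f)
  have "f v = f (1, 0) * fst v + f (0, 1) * snd v" for v
  proof -
    interpret bounded_linear f by fact
    have "f v = f (fst v *\<^sub>R (1, 0) + snd v *\<^sub>R (0, 1))" by simp
    also have "\<dots> = f (1, 0) * fst v + f (0, 1) * snd v"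
      unfolding add scaleR by simp
    finally show ?thesis .
  qed
  then have eq: "f = (\<lambda>v. f (1, 0) * fst v + f (0, 1) * snd v)" by (rule ext)
  have "(f has_derivative (\<lambda>v. f (1, 0) * fst v + f (0, 1) * snd v)) (at p)" for p
    by (rule has_derivative_eq_rhs[OF bounded_linear_imp_has_derivative[OF linear(1)] eq])
  then show ?case
    by (intro linear(2)[of "\<lambda>_. f (1, 0)" "\<lambda>_. f (0, 1)"] real_polynomial_function.intros(2))
next
  case (const c)
  show ?case
    by (rule const[of "\<lambda>_. 0" "\<lambda>_. 0"]) auto
next
  case (add f g)
  obtain fx fy where f: "real_polynomial_function fx" "real_polynomial_function fy"
    "\<And>p. (f has_derivative (\<lambda>v. fx p * fst v + fy p * snd v)) (at p)" using add.IH(1) by blast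
  obtain gx gy where g: "real_polynomial_function gx" "real_polynomial_function gy"
    "\<And>p. (g has_derivative (\<lambda>v. gx p * fst v + gy p * snd v)) (at p)" using add.IH(2) by blast
  have "((\<lambda>p. f p + g p) has_derivative (\<lambda>v. (fx p + gx p) * fst v + (fy p + gy p) * snd v)) (at p)" for p
    by (rule has_derivative_eq_rhs[OF has_derivative_add[OF f(3) g(3)]]) (auto simp: algebra_simps)
  then show ?case
    using f g by (intro add.prems[of "\<lambda>p. fx p + gx p" "\<lambda>p. fy p + gy p"] real_polynomial_function.intros(3))
next
  case (mult f g)
  obtain fx fy where f: "real_polynomial_function fx" "real_polynomial_function fy"
    "\<And>p. (f has_derivative (\<lambda>v. fx p * fst v + fy p * snd v)) (at p)" using mult.IH(1) by blast
  obtain gx gy where g: "real_polynomial_function gx" "real_polynomial_function gy"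
    "\<And>p. (g has_derivative (\<lambda>v. gx p * fst v + gy p * snd v)) (at p)" using mult.IH(2) by blast
  have "((\<lambda>p. f p * g p) has_derivative
      (\<lambda>v. (f p * gx p + fx p * g p) * fst v + (f p * gy p + fy p * g p) * snd v)) (at p)" for p
    by (rule has_derivative_eq_rhs[OF has_derivative_mult[OF f(3) g(3)]]) (auto simp: algebra_simps)
  then show ?case
    using f g mult.hyps
    by (intro mult.prems[of "\<lambda>p. f p * gx p + fx p * g p" "\<lambda>p. f p * gy p + fy p * g p"]
      real_polynomial_function.intros(3) real_polynomial_function.intros(4))
qed

text \<open>The factor theorem in the second variable. It will divide the transverse derivative of a
  symmetric polynomial by \<open>t\<close>.\<close>

lemma real_polynomial_function_split_snd:
  fixes f :: "real \<times> real \<Rightarrow> real"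
  assumes "real_polynomial_function f"
  obtains q where "real_polynomial_function q" "\<And>u t. f (u, t) = f (u, 0) + t * q (u, t)"
  using assms
proof (induction arbitrary: thesis)
  case (linear f)
  have eq: "f (u, t) = f (u, 0) + t * f (0, 1)" for u t
  proof -
    interpret bounded_linear f by fact
    have "f (u, t) = f ((u, 0) + t *\<^sub>R (0, 1))" by simp
    then show ?thesis unfolding add scaleR by simp
  qed
  show ?case by (rule linear(2)[of "\<lambda>_. f (0, 1)"], blast, rule eq)
next
  case (const c)
  show ?case by (rule const[of "\<lambda>_. 0"]) auto
next
  case (add f g)
  obtain p where p: "real_polynomial_function p" "\<And>u t. f (u, t) = f (u, 0) + t * p (u, t)"
    by (rule add.IH(1)) (rule that)
  obtain q where q: "real_polynomial_function q" "\<And>u t. g (u, t) = g (u, 0) + t * q (u, t)"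
    by (rule add.IH(2)) (rule that)
  have "f (u, t) + g (u, t) = f (u, 0) + g (u, 0) + t * (p (u, t) + q (u, t))" for u t
    using p(2)[of u t] q(2)[of u t] by (simp add: algebra_simps)
  then show ?case
    by (intro add.prems[of "\<lambda>v. p v + q v"] real_polynomial_function.intros(3) p q)
next
  case (mult f g)
  obtain p where p: "real_polynomial_function p" "\<And>u t. f (u, t) = f (u, 0) + t * p (u, t)"
    by (rule mult.IH(1)) (rule that)
  obtain q where q: "real_polynomial_function q" "\<And>u t. g (u, t) = g (u, 0) + t * q (u, t)"
    by (rule mult.IH(2)) (rule that)
  \<comment> \<open>Multiplying \<open>f - t p\<close> by \<open>g - t q\<close>, the values at
    \<open>t = 0\<close>, and collecting the factor \<open>t\<close> gives this cofactor.\<close>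
  define r where "r = (\<lambda>v. f v * q v + p v * g v - snd v * p v * q v)"
  have "f (u, t) * g (u, t) = f (u, 0) * g (u, 0) + t * r (u, t)" for u t
  proof -
    have "f (u, 0) = f (u, t) - t * p (u, t)" "g (u, 0) = g (u, t) - t * q (u, t)"
      using p(2)[of u t] q(2)[of u t] by auto
    then show ?thesis by (simp only: r_def snd_conv) (simp add: algebra_simps)
  qed
  moreover have "real_polynomial_function r"
    unfolding r_def
    by (intro real_polynomial_function_diff real_polynomial_function.intros(3) real_polynomial_function.intros(4)
      real_polynomial_function.intros(1)[OF bounded_linear_snd] p q mult.hyps)
  ultimately show ?case by (intro mult.prems[of r])
qed

lemma real_polynomial_function_polar:
  assumes "real_polynomial_function f"
  shows "real_polynomial_function (\<lambda>q. f (polar q))"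
proof -
  have "real_polynomial_function (\<lambda>q. h (polar q))" if "bounded_linear h" for h
  proof -
    interpret bounded_linear h by fact
    have eq: "h v = fst v * h (1, 0) + snd v * h (0, 1)" for v
    proof -
      have "h v = h (fst v *\<^sub>R (1, 0) + snd v *\<^sub>R (0, 1))" by simp
      then show ?thesis unfolding add scaleR by simp
    qed
    have "(\<lambda>q. h (polar q)) =
        (\<lambda>q. fst q * (1 + snd q) / 2 * h (1, 0) + fst q * (1 - snd q) / 2 * h (0, 1))"
    proof
      show "h (polar q) = fst q * (1 + snd q) / 2 * h (1, 0) + fst q * (1 - snd q) / 2 * h (0, 1)" for q
        using eq[of "polar q"] by (simp add: polar_def split_def)
    qed
    then show ?thesis
      by (auto intro!: real_polynomial_function_diff real_polynomial_function_divide
          real_polynomial_function.intros(2-4)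
          real_polynomial_function.intros(1)[OF bounded_linear_fst]
          real_polynomial_function.intros(1)[OF bounded_linear_snd])
  qed
  then have "polynomial_function polar" by (simp add: polynomial_function_def o_def)
  from real_polynomial_function_compose[OF this assms] show ?thesis by (simp add: o_def)
qed

lemmas real_polynomial_function_intros =
  real_polynomial_function_diff real_polynomial_function_divide real_polynomial_function_power
  real_polynomial_function.intros(2-4) real_polynomial_function_polar
  real_polynomial_function.intros(1)[OF bounded_linear_fst]
  real_polynomial_function.intros(1)[OF bounded_linear_snd]

lemma continuous_on_real_polynomial_function:
  "real_polynomial_function (f :: 'a::euclidean_space \<Rightarrow> real) \<Longrightarrow> continuous_on S f"
  by (simp add: continuous_on_polymonial_function real_polynomial_function_eq)

section \<open>The operator in the two coordinate systems\<close>

lemma has_real_derivative_partials: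
  fixes f :: "real \<times> real \<Rightarrow> real"
  assumes "(f has_derivative (\<lambda>v. a * fst v + b * snd v)) (at (x, y))"
  shows "((\<lambda>t. f (t, y)) has_real_derivative a) (at x)"
    and "((\<lambda>t. f (x, t)) has_real_derivative b) (at y)"
proof -
  have "((\<lambda>t. (t, y)) has_derivative (\<lambda>t. (t, 0))) (at x)"
    "((\<lambda>t. (x, t)) has_derivative (\<lambda>t. (0, t))) (at y)"
    by (auto intro!: derivative_eq_intros)
  from has_derivative_compose[OF this(1) assms] has_derivative_compose[OF this(2) assms]
  show "((\<lambda>t. f (t, y)) has_real_derivative a) (at x)"
    and "((\<lambda>t. f (x, t)) has_real_derivative b) (at y)"
    by (auto elim!: has_derivative_imp_has_field_derivative)
qed

text \<open>In logarithmic form the power survives as a factor, so the product rule merely adds the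
  logarithmic derivatives of the factors of the weight.\<close>

lemma has_real_derivative_powr_base:
  assumes "(g has_real_derivative m) (at x)" "0 < g x"
  shows "((\<lambda>t. g t powr r) has_real_derivative g x powr r * (r * m / g x)) (at x)"
  using DERIV_powr[OF assms DERIV_const[of r]] by (simp add: mult.commute)

lemma
  assumes "0 < y" "y < x" "x + y < 1"
  shows weight_deriv_x: "((\<lambda>t. weight \<alpha> \<gamma> \<kappa> (t, y)) has_real_derivative
      weight \<alpha> \<gamma> \<kappa> (x, y) * (\<alpha> / x - \<gamma> / (1 - x - y) + (2 * \<kappa> + 1) / (x - y))) (at x)"
    and weight_deriv_y: "((\<lambda>t. weight \<alpha> \<gamma> \<kappa> (x, t)) has_real_derivative
      weight \<alpha> \<gamma> \<kappa> (x, y) * (\<alpha> / y - \<gamma> / (1 - x - y) - (2 * \<kappa> + 1) / (x - y))) (at y)"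
proof -
  have 1: "((\<lambda>t. (t * y) powr \<alpha>) has_real_derivative (x * y) powr \<alpha> * (\<alpha> * y / (x * y))) (at x)"
    "((\<lambda>t. (1 - t - y) powr \<gamma>) has_real_derivative (1 - x - y) powr \<gamma> * (\<gamma> * - 1 / (1 - x - y))) (at x)"
    "((\<lambda>t. (t - y) powr (2 * \<kappa> + 1)) has_real_derivative
       (x - y) powr (2 * \<kappa> + 1) * ((2 * \<kappa> + 1) * 1 / (x - y))) (at x)"
    by (rule has_real_derivative_powr_base; use assms in \<open>auto intro!: derivative_eq_intros\<close>)+
  have "((\<lambda>t. (t * y) powr \<alpha> * (1 - t - y) powr \<gamma> * (t - y) powr (2 * \<kappa> + 1)) has_real_derivative
      (x * y) powr \<alpha> * (1 - x - y) powr \<gamma> * (x - y) powr (2 * \<kappa> + 1) *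
      (\<alpha> / x - \<gamma> / (1 - x - y) + (2 * \<kappa> + 1) / (x - y))) (at x)"
    by (rule DERIV_cong[OF DERIV_mult[OF DERIV_mult[OF 1(1,2)] 1(3)]])
       (use assms in \<open>simp add: ring_distribs minus_divide_left[symmetric] add_divide_distrib diff_divide_distrib mult_ac\<close>)
  \<comment> \<open>On the open half-line \<open>t > y\<close> the absolute value in the weight
    drops out, and the weight coincides with the product just differentiated.\<close>
  then show "((\<lambda>t. weight \<alpha> \<gamma> \<kappa> (t, y)) has_real_derivative
      weight \<alpha> \<gamma> \<kappa> (x, y) * (\<alpha> / x - \<gamma> / (1 - x - y) + (2 * \<kappa> + 1) / (x - y))) (at x)"
    by (rule DERIV_cong[OF has_field_derivative_transform_within_open[where S = "{y<..}"]])
       (use assms in \<open>auto simp: weight_def\<close>)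
  have 2: "((\<lambda>t. (x * t) powr \<alpha>) has_real_derivative (x * y) powr \<alpha> * (\<alpha> * x / (x * y))) (at y)"
    "((\<lambda>t. (1 - x - t) powr \<gamma>) has_real_derivative (1 - x - y) powr \<gamma> * (\<gamma> * - 1 / (1 - x - y))) (at y)"
    "((\<lambda>t. (x - t) powr (2 * \<kappa> + 1)) has_real_derivative
       (x - y) powr (2 * \<kappa> + 1) * ((2 * \<kappa> + 1) * - 1 / (x - y))) (at y)"
    by (rule has_real_derivative_powr_base; use assms in \<open>auto intro!: derivative_eq_intros\<close>)+
  have "((\<lambda>t. (x * t) powr \<alpha> * (1 - x - t) powr \<gamma> * (x - t) powr (2 * \<kappa> + 1)) has_real_derivative
      (x * y) powr \<alpha> * (1 - x - y) powr \<gamma> * (x - y) powr (2 * \<kappa> + 1) *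
      (\<alpha> / y - \<gamma> / (1 - x - y) - (2 * \<kappa> + 1) / (x - y))) (at y)"
    by (rule DERIV_cong[OF DERIV_mult[OF DERIV_mult[OF 2(1,2)] 2(3)]])
       (use assms in \<open>simp add: ring_distribs minus_divide_left[symmetric] add_divide_distrib diff_divide_distrib mult_ac\<close>)
  then show "((\<lambda>t. weight \<alpha> \<gamma> \<kappa> (x, t)) has_real_derivative
      weight \<alpha> \<gamma> \<kappa> (x, y) * (\<alpha> / y - \<gamma> / (1 - x - y) - (2 * \<kappa> + 1) / (x - y))) (at y)"
    by (rule DERIV_cong[OF has_field_derivative_transform_within_open[where S = "{..<x}"]])
       (use assms in \<open>auto simp: weight_def\<close>)
qed

lemma weight_pos:
  assumes "0 < y" "y < x" "x + y < 1"
  shows "0 < weight \<alpha> \<gamma> \<kappa> (x, y)"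
  using assms by (simp add: weight_def)

text \<open>
  The mixed partials enter only through \<open>fxy + fyx\<close>, here and in the product coordinates, so their
  equality is never needed.
\<close>

lemma D1_expand:
  assumes f: "\<And>p. (f has_derivative (\<lambda>v. fx p * fst v + fy p * snd v)) (at p)"
    and fx: "\<And>p. (fx has_derivative (\<lambda>v. fxx p * fst v + fxy p * snd v)) (at p)"
    and fy: "\<And>p. (fy has_derivative (\<lambda>v. fyx p * fst v + fyy p * snd v)) (at p)"
    and xy: "0 < y" "y < x" "x + y < 1"
  shows "D1 \<alpha> \<gamma> \<kappa> f (x, y) =
    x * (1 - x) * fxx (x, y) - x * y * (fxy (x, y) + fyx (x, y)) + y * (1 - y) * fyy (x, y)
    + (\<alpha> + 1 - (2 * \<alpha> + \<gamma> + 2 * \<kappa> + 4) * x) * fx (x, y)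
    + (\<alpha> + 1 - (2 * \<alpha> + \<gamma> + 2 * \<kappa> + 4) * y) * fy (x, y)
    + (2 * \<kappa> + 1) * (x * fx (x, y) - y * fy (x, y)) / (x - y)"
proof -
  define k where "k = 2 * \<kappa> + 1"
  define w where "w = weight \<alpha> \<gamma> \<kappa> (x, y)"
  define z where "z = 1 - x - y"
  define d where "d = x - y"
  have w0: "w > 0" unfolding w_def using xy by (rule weight_pos)
  have nz: "x \<noteq> 0" "y \<noteq> 0" "z \<noteq> 0" "d \<noteq> 0" using xy by (auto simp: z_def d_def)
  have 0: "dx f = fx" "dy f = fy"
    using has_real_derivative_partials[OF f] by (auto simp: fun_eq_iff dx_def dy_def intro!: DERIV_imp_deriv)
  then have 00: "dz f = (\<lambda>p. fy p - fx p)" by (auto simp: dz_def)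
  \<comment> \<open>\<open>l1\<close> and \<open>l2\<close> are the logarithmic derivatives of the
    weight. With them every derivative of a flux term carries the factor \<open>w\<close>, which the
    division in \<open>D1\<close> cancels.\<close>
  define l1 where "l1 = \<alpha> / x - \<gamma> / z + k / d"
  define l2 where "l2 = \<alpha> / y - \<gamma> / z - k / d"
  note wx = weight_deriv_x[OF xy, of \<alpha> \<gamma> \<kappa>, folded k_def w_def z_def d_def, folded l1_def l2_def]
  note wy = weight_deriv_y[OF xy, of \<alpha> \<gamma> \<kappa>, folded k_def w_def z_def d_def, folded l1_def l2_def]
  note px = has_real_derivative_partials(1)[OF fx, where x = x and y = y] has_real_derivative_partials(1)[OF fy, where x = x and y = y]
  note py = has_real_derivative_partials(2)[OF fx, where x = x and y = y] has_real_derivative_partials(2)[OF fy, where x = x and y = y]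
  have 1: "dx (\<lambda>(x, y). x * (1 - x - y) * weight \<alpha> \<gamma> \<kappa> (x, y) * dx f (x, y)) (x, y) =
     w * ((z - x + x * z * l1) * fx (x, y) + x * z * fxx (x, y))"
  proof -
    have p: "((\<lambda>x. x * (1 - x - y)) has_real_derivative z - x) (at x)"
      by (auto intro!: derivative_eq_intros simp: z_def)
    show ?thesis
      unfolding dx_def[of "case_prod _"] prod.case 0 00
      by (rule DERIV_imp_deriv, rule DERIV_cong[OF DERIV_mult[OF DERIV_mult[OF p wx]]], rule px(1))
         (simp only: w_def[symmetric] z_def[symmetric], simp add: algebra_simps)
  qed
  have 2: "dy (\<lambda>(x, y). y * (1 - x - y) * weight \<alpha> \<gamma> \<kappa> (x, y) * dy f (x, y)) (x, y) =
     w * ((z - y + y * z * l2) * fy (x, y) + y * z * fyy (x, y))"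
  proof -
    have p: "((\<lambda>y. y * (1 - x - y)) has_real_derivative z - y) (at y)"
      by (auto intro!: derivative_eq_intros simp: z_def)
    show ?thesis
      unfolding dy_def[of "case_prod _"] prod.case 0 00
      by (rule DERIV_imp_deriv, rule DERIV_cong[OF DERIV_mult[OF DERIV_mult[OF p wy]]], rule py(2))
         (simp only: w_def[symmetric] z_def[symmetric], simp add: algebra_simps)
  qed
  have 3: "dx (\<lambda>(x, y). x * y * weight \<alpha> \<gamma> \<kappa> (x, y) * dz f (x, y)) (x, y) =
     w * ((y + x * y * l1) * (fy (x, y) - fx (x, y)) + x * y * (fyx (x, y) - fxx (x, y)))"
  proof -
    have p: "((\<lambda>x. x * y) has_real_derivative y) (at x)"
      by (auto intro!: derivative_eq_intros simp: z_def)
    show ?thesis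
      unfolding dx_def[of "case_prod _"] prod.case 0 00
      by (rule DERIV_imp_deriv, rule DERIV_cong[OF DERIV_mult[OF DERIV_mult[OF p wx]]], rule DERIV_diff[OF px(2) px(1)])
         (simp only: w_def[symmetric] z_def[symmetric], simp add: algebra_simps)
  qed
  have 4: "dy (\<lambda>(x, y). x * y * weight \<alpha> \<gamma> \<kappa> (x, y) * dz f (x, y)) (x, y) =
     w * ((x + x * y * l2) * (fy (x, y) - fx (x, y)) + x * y * (fyy (x, y) - fxy (x, y)))"
  proof -
    have p: "((\<lambda>y. x * y) has_real_derivative x) (at y)"
      by (auto intro!: derivative_eq_intros simp: z_def)
    show ?thesis
      unfolding dy_def[of "case_prod _"] prod.case 0 00
      by (rule DERIV_imp_deriv, rule DERIV_cong[OF DERIV_mult[OF DERIV_mult[OF p wy]]], rule DERIV_diff[OF py(2) py(1)])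
         (simp only: w_def[symmetric] z_def[symmetric], simp add: algebra_simps)
  qed
  \<comment> \<open>This difference arises because \<open>dz\<close> subtracts the
    \<open>x\<close>-derivative of the third flux from its \<open>y\<close>-derivative; the
    \<gamma>-terms cancel.\<close>
  have l12: "\<alpha> / y - \<alpha> / x - 2 * k / d = l2 - l1" by (simp add: l1_def l2_def)
  have "D1 \<alpha> \<gamma> \<kappa> f (x, y) =
    (z - x + x * z * (\<alpha> / x - \<gamma> / z + k / d)) * fx (x, y) + x * z * fxx (x, y)
    + ((z - y + y * z * (\<alpha> / y - \<gamma> / z - k / d)) * fy (x, y) + y * z * fyy (x, y))
    + ((x - y + x * y * (\<alpha> / y - \<alpha> / x - 2 * k / d)) * (fy (x, y) - fx (x, y))
       + x * y * (fyy (x, y) - fxy (x, y) - fyx (x, y) + fxx (x, y)))"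
    unfolding D1_def dz_def[of "case_prod _"] 1 2 3 4 w_def[symmetric] l1_def[symmetric] l2_def[symmetric] l12
    using w0 by (simp add: ring_distribs mult_ac)
  also have "\<dots> = x * (1 - x) * fxx (x, y) - x * y * (fxy (x, y) + fyx (x, y)) + y * (1 - y) * fyy (x, y)
    + (\<alpha> + 1 - (2 * \<alpha> + \<gamma> + k + 3) * x) * fx (x, y)
    + (\<alpha> + 1 - (2 * \<alpha> + \<gamma> + k + 3) * y) * fy (x, y)
    + k * (x * fx (x, y) - y * fy (x, y)) / d"
  proof -
    have e: "x * z * (\<alpha> / x - \<gamma> / z + k / d) = \<alpha> * z - \<gamma> * x + x * z * (k / d)"
      "y * z * (\<alpha> / y - \<gamma> / z - k / d) = \<alpha> * z - \<gamma> * y - y * z * (k / d)"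
      "x * y * (\<alpha> / y - \<alpha> / x - 2 * k / d) = \<alpha> * d - 2 * x * y * (k / d)"
      using nz by (simp_all add: field_simps) (simp_all add: d_def algebra_simps)
    \<comment> \<open>Once \<open>x\<close>, \<open>y\<close> and \<open>z\<close> are cleared from
      the denominators, \<open>k / d\<close> is the only quotient left. Writing \<open>k\<close> as
      \<open>q * (x - y)\<close> turns the claim into a polynomial identity.\<close>
    define q where "q = k / d"
    have k: "k = q * (x - y)" using nz by (simp add: q_def d_def)
    have kd: "k * (x * fx (x, y) - y * fy (x, y)) / d = q * (x * fx (x, y) - y * fy (x, y))"
      by (simp add: q_def)
    show ?thesis unfolding kd e unfolding q_def[symmetric] by (simp add: k z_def d_def algebra_simps)
  qed
  finally show ?thesis by (simp add: k_def d_def algebra_simps)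
qed

section \<open>The operator in product coordinates\<close>

lemma has_real_derivative_polar:
  assumes "\<And>p. (f has_derivative (\<lambda>v. fx p * fst v + fy p * snd v)) (at p)"
  shows "((\<lambda>s. f (polar (s, t))) has_real_derivative
           ((1 + t) * fx (polar (u, t)) + (1 - t) * fy (polar (u, t))) / 2) (at u)"
    and "((\<lambda>s. f (polar (u, s))) has_real_derivative u * (fx (polar (u, t)) - fy (polar (u, t))) / 2) (at t)"
proof -
  have "((\<lambda>s. polar (s, t)) has_derivative (\<lambda>h. ((1 + t) / 2 * h, (1 - t) / 2 * h))) (at u)"
    "((\<lambda>s. polar (u, s)) has_derivative (\<lambda>h. (u / 2 * h, - (u / 2) * h))) (at t)"
    by (auto simp: polar_def intro!: derivative_eq_intros)
  from this[THEN has_derivative_compose, OF assms]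
  show "((\<lambda>s. f (polar (s, t))) has_real_derivative
           ((1 + t) * fx (polar (u, t)) + (1 - t) * fy (polar (u, t))) / 2) (at u)"
    and "((\<lambda>s. f (polar (u, s))) has_real_derivative u * (fx (polar (u, t)) - fy (polar (u, t))) / 2) (at t)"
    by (auto elim!: has_derivative_imp_has_field_derivative simp: field_simps)
qed

text \<open>Symmetry makes \<open>fx - fy\<close> vanish at \<open>t = 0\<close>, hence divisible by
  \<open>t\<close>; so the \<open>t\<close>-derivative of \<open>f\<close> is
  \<open>u * t * K\<close> with \<open>K\<close> polynomial. The factor \<open>u\<close> cancels the
  \<open>1 / u\<close> of the angular part, and the factor \<open>t\<close> cancels the singularity
  at \<open>x = y\<close>. The terms in \<open>K\<close> and \<open>Kt\<close> are the angular part,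
  the terms in \<open>Fu\<close> and \<open>Fuu\<close> the radial part.\<close>

lemma D1_polar:
  assumes "symmetric_polynomial f"
  obtains Fu Fuu K Kt where
    "real_polynomial_function Fu" "real_polynomial_function Fuu"
    "real_polynomial_function K" "real_polynomial_function Kt"
    "\<And>u t. ((\<lambda>s. f (polar (s, t))) has_real_derivative Fu (u, t)) (at u)"
    "\<And>u t. ((\<lambda>s. Fu (s, t)) has_real_derivative Fuu (u, t)) (at u)"
    "\<And>u t. ((\<lambda>s. f (polar (u, s))) has_real_derivative u * t * K (u, t)) (at t)"
    "\<And>u t. ((\<lambda>s. K (u, s)) has_real_derivative Kt (u, t)) (at t)"
    "\<And>\<alpha> \<gamma> \<kappa> u t. 0 < u \<Longrightarrow> u < 1 \<Longrightarrow> 0 < t \<Longrightarrow> t < 1 \<Longrightarrow>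
       D1 \<alpha> \<gamma> \<kappa> f (polar (u, t)) =
         u * (1 - u) * Fuu (u, t) + (2 * \<alpha> + 2 * \<kappa> + 3 - (2 * \<alpha> + \<gamma> + 2 * \<kappa> + 4) * u) * Fu (u, t)
         + ((2 * \<kappa> + 2) * (1 - t\<^sup>2) - 2 * (\<alpha> + 1) * t\<^sup>2) * K (u, t) + (1 - t\<^sup>2) * t * Kt (u, t)"
proof -
  have poly: "real_polynomial_function f" and sym: "f (x, y) = f (y, x)" for x y
    using assms by (auto simp: symmetric_polynomial_def)
  obtain fx fy where pf: "real_polynomial_function fx" "real_polynomial_function fy"
    and f: "\<And>p. (f has_derivative (\<lambda>v. fx p * fst v + fy p * snd v)) (at p)"
    by (rule real_polynomial_function_partials[OF poly]) (rule that)
  obtain fxx fxy where pfx: "real_polynomial_function fxx" "real_polynomial_function fxy"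
    and fx: "\<And>p. (fx has_derivative (\<lambda>v. fxx p * fst v + fxy p * snd v)) (at p)"
    by (rule real_polynomial_function_partials[OF pf(1)]) (rule that)
  obtain fyx fyy where pfy: "real_polynomial_function fyx" "real_polynomial_function fyy"
    and fy: "\<And>p. (fy has_derivative (\<lambda>v. fyx p * fst v + fyy p * snd v)) (at p)"
    by (rule real_polynomial_function_partials[OF pf(2)]) (rule that)
  \<comment> \<open>By symmetry, fixing either argument at \<open>c\<close> gives the same function
    of one variable; its derivative at \<open>c\<close> is both \<open>fx (c, c)\<close> and
    \<open>fy (c, c)\<close>.\<close>
  have diag: "fx (c, c) = fy (c, c)" for c
    using DERIV_unique has_real_derivative_partials[OF f, where x = c and y = c]
    unfolding sym[of c] by blast
  have pG: "real_polynomial_function (\<lambda>q. fx (polar q) - fy (polar q))"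
    by (intro real_polynomial_function_diff real_polynomial_function_polar pf)
  obtain q where pq: "real_polynomial_function q"
    and q: "\<And>u t. fx (polar (u, t)) - fy (polar (u, t)) = fx (polar (u, 0)) - fy (polar (u, 0)) + t * q (u, t)"
    by (rule real_polynomial_function_split_snd[OF pG]) (rule that)
  obtain qu qt where pqt: "real_polynomial_function qu" "real_polynomial_function qt"
    and qt: "\<And>p. (q has_derivative (\<lambda>v. qu p * fst v + qt p * snd v)) (at p)"
    by (rule real_polynomial_function_partials[OF pq]) (rule that)
  \<comment> \<open>\<open>polar (u, 0)\<close> lies on the diagonal, so the term at
    \<open>t = 0\<close> drops out.\<close>
  have G: "fx (polar (u, t)) - fy (polar (u, t)) = t * q (u, t)" for u t
    using q[of u t] diag by (simp add: polar_def)
  \<comment> \<open>Differentiating \<open>fx - fy\<close> along \<open>t\<close> in two ways, by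
    the chain rule and through \<open>t * q\<close>, expresses the transverse second derivative by
    \<open>q\<close> and \<open>qt\<close>.\<close>
  have Gt: "u * (fxx (polar (u, t)) - fxy (polar (u, t)) - fyx (polar (u, t)) + fyy (polar (u, t))) / 2
      = q (u, t) + t * qt (u, t)" for u t
  proof (rule DERIV_unique)
    show "((\<lambda>s. fx (polar (u, s)) - fy (polar (u, s))) has_real_derivative
        u * (fxx (polar (u, t)) - fxy (polar (u, t)) - fyx (polar (u, t)) + fyy (polar (u, t))) / 2) (at t)"
      by (rule DERIV_cong[OF DERIV_diff[OF has_real_derivative_polar(2)[OF fx] has_real_derivative_polar(2)[OF fy]]])
         (simp add: field_simps)
    show "((\<lambda>s. fx (polar (u, s)) - fy (polar (u, s))) has_real_derivative q (u, t) + t * qt (u, t)) (at t)"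
      unfolding G
      by (rule DERIV_cong[OF DERIV_mult[OF DERIV_ident has_real_derivative_partials(2)[OF qt]]]) simp
  qed
  define Fu where "Fu = (\<lambda>p. ((1 + snd p) * fx (polar p) + (1 - snd p) * fy (polar p)) / 2)"
  define Fuu where "Fuu = (\<lambda>p. ((1 + snd p) * ((1 + snd p) * fxx (polar p) + (1 - snd p) * fxy (polar p))
     + (1 - snd p) * ((1 + snd p) * fyx (polar p) + (1 - snd p) * fyy (polar p))) / 4)"
  show thesis
  proof (rule that[of Fu Fuu "\<lambda>p. q p / 2" "\<lambda>p. qt p / 2"])
    show "real_polynomial_function Fu" "real_polynomial_function Fuu"
      unfolding Fu_def Fuu_def by (intro real_polynomial_function_intros pf pfx pfy)+
    show "real_polynomial_function (\<lambda>p. q p / 2)" "real_polynomial_function (\<lambda>p. qt p / 2)"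
      by (intro real_polynomial_function_intros pq pqt)+
    show "((\<lambda>s. f (polar (s, t))) has_real_derivative Fu (u, t)) (at u)" for u t
      using has_real_derivative_polar(1)[OF f] by (simp add: Fu_def)
    show "((\<lambda>s. Fu (s, t)) has_real_derivative Fuu (u, t)) (at u)" for u t
      unfolding Fu_def Fuu_def snd_conv
      by (rule DERIV_cong[OF DERIV_cdivide[OF DERIV_add[OF
            DERIV_cmult[OF has_real_derivative_polar(1)[OF fx]]
            DERIV_cmult[OF has_real_derivative_polar(1)[OF fy]]]]])
         (simp add: field_simps)
    show "((\<lambda>s. f (polar (u, s))) has_real_derivative u * t * (q (u, t) / 2)) (at t)" for u t
      using has_real_derivative_polar(2)[OF f, of u t] by (simp add: G mult.assoc)
    show "((\<lambda>s. q (u, s) / 2) has_real_derivative qt (u, t) / 2) (at t)" for u t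
      by (intro DERIV_cdivide has_real_derivative_partials(2)[OF qt])
    fix \<alpha> \<gamma> \<kappa> u t :: real
    assume ut: "0 < u" "u < 1" "0 < t" "t < 1"
    define x y where "x = u * (1 + t) / 2" and "y = u * (1 - t) / 2"
    have polar: "polar (u, t) = (x, y)" by (simp add: polar_def x_def y_def)
    define A B where "A = fx (x, y)" and "B = fy (x, y)"
    define k where "k = 2 * \<kappa> + 1"
    define c where "c = 2 * \<alpha> + \<gamma> + 2 * \<kappa> + 4"
    define P M R where "P = fxx (x, y)" and "M = fxy (x, y) + fyx (x, y)" and "R = fyy (x, y)"
    define Q where "Q = q (u, t) / 2"
    define Qt where "Qt = qt (u, t) / 2"
    have xy: "0 < y" "y < x" "x + y < 1"
      using ut by (simp_all add: x_def y_def field_simps)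
    have D: "D1 \<alpha> \<gamma> \<kappa> f (polar (u, t)) =
      x * (1 - x) * P - x * y * M + y * (1 - y) * R + (\<alpha> + 1 - c * x) * A + (\<alpha> + 1 - c * y) * B
      + k * (x * A - y * B) / (x - y)"
      unfolding polar D1_expand[OF f fx fy xy] by (simp add: P_def M_def R_def A_def B_def k_def c_def)
    have AB: "A = B + 2 * t * Q"
      using G[of u t] by (simp add: polar A_def B_def Q_def)
    have S': "u * (P - M + R) / 2 = 2 * Q + 2 * t * Qt"
      using Gt[of u t] by (simp add: polar P_def M_def R_def Q_def Qt_def algebra_simps)
    \<comment> \<open>The coefficient is \<open>x * y / u\<close>: it is what multiplies
      \<open>P - M + R\<close> after the radial part is split off from the second-order
      terms.\<close>
    have "u * (1 - t\<^sup>2) / 4 * (P - M + R) = (1 - t\<^sup>2) / 2 * (u * (P - M + R) / 2)"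
      by simp
    then have S: "u * (1 - t\<^sup>2) / 4 * (P - M + R) = (1 - t\<^sup>2) * (Q + t * Qt)"
      unfolding S' by (simp add: field_simps)
    have Fu: "Fu (u, t) = B + (1 + t) * t * Q"
      by (simp add: Fu_def polar A_def[symmetric] B_def[symmetric] AB field_simps)
    have Fuu: "Fuu (u, t) = ((1 + t)\<^sup>2 * P + (1 - t\<^sup>2) * M + (1 - t)\<^sup>2 * R) / 4"
      by (simp add: Fuu_def polar P_def M_def R_def power2_eq_square algebra_simps)
    have second: "x * (1 - x) * P - x * y * M + y * (1 - y) * R =
        u * (1 - u) * Fuu (u, t) + (1 - t\<^sup>2) * (Q + t * Qt)"
      unfolding S[symmetric] Fuu x_def y_def by (simp add: power2_eq_square field_simps)
    have "k * (x * A - y * B) / (x - y) = k * (B + (1 + t) * Q)"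
      using ut by (simp add: x_def y_def AB field_simps)
    then show "D1 \<alpha> \<gamma> \<kappa> f (polar (u, t)) =
         u * (1 - u) * Fuu (u, t) + (2 * \<alpha> + 2 * \<kappa> + 3 - (2 * \<alpha> + \<gamma> + 2 * \<kappa> + 4) * u) * Fu (u, t)
         + ((2 * \<kappa> + 2) * (1 - t\<^sup>2) - 2 * (\<alpha> + 1) * t\<^sup>2) * (q (u, t) / 2)
         + (1 - t\<^sup>2) * t * (qt (u, t) / 2)"
      unfolding D second c_def[symmetric] Q_def[symmetric] Qt_def[symmetric] Fu
      by (simp add: AB x_def y_def k_def power2_eq_square field_simps)
  qed
qed

text \<open>Since \<open>D1\<close> is defined through \<open>deriv\<close>, its measurability on
  the whole plane is not immediate. Agreement with a Borel function on the open triangle suffices,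
  because the weighted integrand vanishes elsewhere.\<close>

lemma D1_borel:
  assumes "symmetric_polynomial f"
  obtains E where "E \<in> borel_measurable borel"
    "\<And>x y. 0 < y \<Longrightarrow> y < x \<Longrightarrow> x + y < 1 \<Longrightarrow> D1 \<alpha> \<gamma> \<kappa> f (x, y) = E (x, y)"
proof -
  have poly: "real_polynomial_function f"
    using assms by (auto simp: symmetric_polynomial_def)
  obtain fx fy where pf: "real_polynomial_function fx" "real_polynomial_function fy"
    and f: "\<And>p. (f has_derivative (\<lambda>v. fx p * fst v + fy p * snd v)) (at p)"
    by (rule real_polynomial_function_partials[OF poly]) (rule that)
  obtain fxx fxy where pfx: "real_polynomial_function fxx" "real_polynomial_function fxy"
    and fx: "\<And>p. (fx has_derivative (\<lambda>v. fxx p * fst v + fxy p * snd v)) (at p)"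
    by (rule real_polynomial_function_partials[OF pf(1)]) (rule that)
  obtain fyx fyy where pfy: "real_polynomial_function fyx" "real_polynomial_function fyy"
    and fy: "\<And>p. (fy has_derivative (\<lambda>v. fyx p * fst v + fyy p * snd v)) (at p)"
    by (rule real_polynomial_function_partials[OF pf(2)]) (rule that)
  note [measurable] = pf[THEN continuous_on_real_polynomial_function, THEN borel_measurable_continuous_onI]
    pfx[THEN continuous_on_real_polynomial_function, THEN borel_measurable_continuous_onI]
    pfy[THEN continuous_on_real_polynomial_function, THEN borel_measurable_continuous_onI]
  define E where "E = (\<lambda>p.
    fst p * (1 - fst p) * fxx p - fst p * snd p * (fxy p + fyx p) + snd p * (1 - snd p) * fyy p
    + (\<alpha> + 1 - (2 * \<alpha> + \<gamma> + 2 * \<kappa> + 4) * fst p) * fx p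
    + (\<alpha> + 1 - (2 * \<alpha> + \<gamma> + 2 * \<kappa> + 4) * snd p) * fy p
    + (2 * \<kappa> + 1) * (fst p * fx p - snd p * fy p) / (fst p - snd p))"
  show thesis
  proof (rule that)
    show "E \<in> borel_measurable borel" unfolding E_def by measurable
    show "D1 \<alpha> \<gamma> \<kappa> f (x, y) = E (x, y)" if "0 < y" "y < x" "x + y < 1" for x y
      unfolding D1_expand[OF f fx fy that] E_def by simp
  qed
qed

section \<open>Integration by parts\<close>

text \<open>The fundamental theorem yields a gauge integral from differentiability in the open
  interval alone, which admits weights singular at the endpoints. Lebesgue integrability of
  \<open>h'\<close> then identifies the two integrals.\<close>

lemma integral_derivative_eq_0:
  fixes h h' :: "real \<Rightarrow> real"
  assumes cont: "continuous_on {0..1} h" and h: "h 0 = 0" "h 1 = 0"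
    and deriv: "\<And>x. 0 < x \<Longrightarrow> x < 1 \<Longrightarrow> (h has_real_derivative h' x) (at x)"
    and int: "set_integrable lborel {0<..<1} h'"
  shows "(LINT x:{0<..<1}|lborel. h' x) = 0"
proof -
  have "(h' has_integral (h 1 - h 0)) {0..1}"
    by (rule fundamental_theorem_of_calculus_interior[OF _ cont])
       (use deriv in \<open>auto simp: has_real_derivative_iff_has_vector_derivative[symmetric]\<close>)
  then have "(h' has_integral 0) {0<..<1}"
    using h by (simp add: has_integral_Icc_iff_Ioo)
  then show ?thesis
    using set_borel_integral_eq_integral(2)[OF int] by (simp add: integral_unique)
qed

section \<open>Integrability against the product weight, and Fubini\<close>

text \<open>This is the integrand of the Beta function with parameters \<open>a + 1\<close> and
  \<open>b + 1\<close>.\<close>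

lemma set_integrable_powr_Ioo:
  fixes a b :: real
  assumes "a > -1" "b > -1"
  shows "set_integrable lborel {0<..<1} (\<lambda>u. u powr a * (1 - u) powr b)"
proof -
  have "{0<..<1::real} \<subseteq> {0..1}" by auto
  then show ?thesis
    using set_integrable_subset[OF integrable_Beta[of "a + 1" "b + 1"], of "{0<..<1}"] assms by simp
qed

text \<open>Factoring \<open>1 - t\<^sup>2\<close> as \<open>(1 + t) * (1 - t)\<close> leaves a Beta
  integrand times \<open>(1 + t) powr a\<close>, whose base stays between 1 and 2.\<close>

lemma set_integrable_powr_square_Ioo:
  fixes a b :: real
  assumes "a > -1" "b > -1"
  shows "set_integrable lborel {0<..<1} (\<lambda>t. (1 - t\<^sup>2) powr a * t powr b)"
proof (rule set_integrable_bound)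
  show "set_integrable lborel {0<..<1} (\<lambda>t. max 1 (2 powr a) * (t powr b * (1 - t) powr a))"
    by (intro set_integrable_mult_right set_integrable_powr_Ioo assms)
  show "set_borel_measurable lborel {0<..<1} (\<lambda>t. (1 - t\<^sup>2) powr a * t powr b)"
    unfolding set_borel_measurable_def by measurable
  have "norm ((1 - t\<^sup>2) powr a * t powr b) \<le> norm (max 1 (2 powr a) * (t powr b * (1 - t) powr a))"
    if t: "0 < t" "t < 1" for t
  proof -
    have "(1 - t\<^sup>2) powr a = (1 + t) powr a * (1 - t) powr a"
      using t by (simp add: powr_mult[symmetric] power2_eq_square algebra_simps)
    moreover have "(1 + t) powr a \<le> max 1 (2 powr a)"
    proof (cases "a \<ge> 0")
      case True
      then have "(1 + t) powr a \<le> 2 powr a" using t by (intro powr_mono2) auto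
      then show ?thesis by simp
    next
      case False
      then have "(1 + t) powr a \<le> 1 powr a" using t by (intro powr_mono2') auto
      then show ?thesis by simp
    qed
    ultimately show ?thesis
      by (simp add: abs_mult mult_ac mult_left_mono)
  qed
  then show "AE t in lborel. t \<in> {0<..<1} \<longrightarrow>
      norm ((1 - t\<^sup>2) powr a * t powr b) \<le> norm (max 1 (2 powr a) * (t powr b * (1 - t) powr a))"
    by auto
qed

lemma integrable_lborel_prod_mult:
  fixes r s :: "real \<Rightarrow> real"
  assumes "integrable lborel r" "integrable lborel s"
  shows "integrable lborel (\<lambda>q. r (fst q) * s (snd q))"
proof -
  note [measurable] = assms[THEN borel_measurable_integrable]
  have "integrable (lborel \<Otimes>\<^sub>M lborel) (\<lambda>q. r (fst q) * s (snd q))"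
    by (rule lborel_pair.Fubini_integrable) (use assms in \<open>auto simp: abs_mult\<close>)
  then show ?thesis by (simp add: lborel_prod)
qed

text \<open>The polynomial is bounded on the compact closed square, so a constant multiple of the
  integrable product weight dominates.\<close>

lemma set_integrable_poly_mult:
  fixes r s :: "real \<Rightarrow> real" and P :: "real \<times> real \<Rightarrow> real"
  assumes r: "set_integrable lborel {0<..<1} r" and s: "set_integrable lborel {0<..<1} s"
    and P: "real_polynomial_function P"
  shows "set_integrable lborel ({0<..<1} \<times> {0<..<1}) (\<lambda>q. P q * (r (fst q) * s (snd q)))"
proof -
  let ?I = "{0<..<1::real}"
  have "compact (P ` ({0..1} \<times> {0..1}))"
    by (intro compact_continuous_image continuous_on_real_polynomial_function P compact_Times compact_Icc)
  then obtain C where C: "\<bar>P q\<bar> \<le> C" if "q \<in> {0..1} \<times> {0..1}" for q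
    using compact_imp_bounded bounded_iff by (metis (no_types, lifting) imageI real_norm_def)
  define w where "w = (\<lambda>q. (indicat_real ?I (fst q) * r (fst q)) * (indicat_real ?I (snd q) * s (snd q)))"
  have int: "integrable lborel w"
    using r s integrable_lborel_prod_mult[of "\<lambda>u. indicat_real ?I u * r u" "\<lambda>u. indicat_real ?I u * s u"]
    by (simp add: set_integrable_def w_def)
  have "integrable lborel (\<lambda>q. indicator (?I \<times> ?I) q * P q * w q)"
  proof (rule Bochner_Integration.integrable_bound[OF integrable_mult_right[OF int, of C]])
    have "P \<in> borel_measurable borel" "?I \<times> ?I \<in> sets borel"
      by (intro borel_measurable_continuous_onI continuous_on_real_polynomial_function P)
         (simp add: open_Times)
    then show "(\<lambda>q. indicator (?I \<times> ?I) q * P q * w q) \<in> borel_measurable lborel"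
      using borel_measurable_integrable[OF int] by simp
    have "norm (indicator (?I \<times> ?I) q * P q * w q) \<le> norm (C * w q)" for q
      using C[of q] by (cases q) (auto simp: indicator_def abs_mult intro!: mult_right_mono)
    then show "AE q in lborel. norm (indicator (?I \<times> ?I) q * P q * w q) \<le> norm (C * w q)"
      by simp
  qed
  moreover have "(\<lambda>q. indicator (?I \<times> ?I) q * P q * w q) =
     (\<lambda>q. indicator (?I \<times> ?I) q *\<^sub>R (P q * (r (fst q) * s (snd q))))"
    by (auto simp: fun_eq_iff indicator_def w_def)
  ultimately show ?thesis by (simp add: set_integrable_def)
qed

text \<open>Fubini in a form whose fibre hypothesis may assume that the slice is integrable, as
  \<open>integral_derivative_eq_0\<close> requires.\<close>

lemma
  fixes h :: "real \<times> real \<Rightarrow> real" and A B :: "real set"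
  assumes int: "set_integrable lborel (A \<times> B) h"
  shows set_integral_eq_0_fst:
      "(\<And>y. y \<in> B \<Longrightarrow> set_integrable lborel A (\<lambda>x. h (x, y)) \<Longrightarrow> (LINT x:A|lborel. h (x, y)) = 0)
       \<Longrightarrow> (LINT q:A \<times> B|lborel. h q) = 0"
    and set_integral_eq_0_snd:
      "(\<And>x. x \<in> A \<Longrightarrow> set_integrable lborel B (\<lambda>y. h (x, y)) \<Longrightarrow> (LINT y:B|lborel. h (x, y)) = 0)
       \<Longrightarrow> (LINT q:A \<times> B|lborel. h q) = 0"
proof -
  let ?h = "\<lambda>x y. indicator (A \<times> B) (x, y) *\<^sub>R h (x, y)"
  have int': "integrable (lborel \<Otimes>\<^sub>M lborel) (case_prod ?h)"
    using int by (simp add: set_integrable_def lborel_prod split_def)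
  have eq: "(LINT q:A \<times> B|lborel. h q) = integral\<^sup>L (lborel \<Otimes>\<^sub>M lborel) (case_prod ?h)"
    by (simp add: set_lebesgue_integral_def lborel_prod split_def)
  {
    assume *: "\<And>y. y \<in> B \<Longrightarrow> set_integrable lborel A (\<lambda>x. h (x, y)) \<Longrightarrow> (LINT x:A|lborel. h (x, y)) = 0"
    have "(\<integral>x. ?h x y \<partial>lborel) = 0" for y
    proof (cases "y \<in> B")
      case True
      then have "(\<integral>x. ?h x y \<partial>lborel) = (LINT x:A|lborel. h (x, y))"
        by (auto simp: set_lebesgue_integral_def indicator_def intro!: Bochner_Integration.integral_cong)
      also have "\<dots> = 0"
        \<comment> \<open>A slice that is not integrable has Bochner integral 0 by convention, so no
          exceptional null set of slices has to be tracked.\<close>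
        using *[OF True]
        by (cases "set_integrable lborel A (\<lambda>x. h (x, y))")
           (auto simp: set_lebesgue_integral_def set_integrable_def not_integrable_integral_eq)
      finally show ?thesis .
    qed simp
    then show "(LINT q:A \<times> B|lborel. h q) = 0"
      unfolding eq lborel_pair.integral_snd[OF int', symmetric] by simp
  }
  {
    assume *: "\<And>x. x \<in> A \<Longrightarrow> set_integrable lborel B (\<lambda>y. h (x, y)) \<Longrightarrow> (LINT y:B|lborel. h (x, y)) = 0"
    have "(\<integral>y. ?h x y \<partial>lborel) = 0" for x
    proof (cases "x \<in> A")
      case True
      then have "(\<integral>y. ?h x y \<partial>lborel) = (LINT y:B|lborel. h (x, y))"
        by (auto simp: set_lebesgue_integral_def indicator_def intro!: Bochner_Integration.integral_cong)
      also have "\<dots> = 0"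
        using *[OF True]
        by (cases "set_integrable lborel B (\<lambda>y. h (x, y))")
           (auto simp: set_lebesgue_integral_def set_integrable_def not_integrable_integral_eq)
      finally show ?thesis .
    qed simp
    then show "(LINT q:A \<times> B|lborel. h q) = 0"
      unfolding eq lborel_pair.integral_fst[OF int', symmetric] by simp
  }
qed

section \<open>Radial and angular integrals without boundary terms\<close>

text \<open>The integrand is the derivative of
  \<open>u powr (a + 1) * (1 - u) powr (b + 1) * m u\<close>; both exponents are positive, so this
  vanishes at 0 and 1.\<close>

lemma integral_radial_eq_0:
  fixes a b :: real and m m' :: "real \<Rightarrow> real"
  assumes "a > -1" "b > -1" and m: "\<And>u. (m has_real_derivative m' u) (at u)"
    and int: "set_integrable lborel {0<..<1}
      (\<lambda>u. ((a + 1 - (a + b + 2) * u) * m u + u * (1 - u) * m' u) * (u powr a * (1 - u) powr b))"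
  shows "(LINT u:{0<..<1}|lborel.
      ((a + 1 - (a + b + 2) * u) * m u + u * (1 - u) * m' u) * (u powr a * (1 - u) powr b)) = 0"
proof (rule integral_derivative_eq_0[where h = "\<lambda>u. u powr (a + 1) * (1 - u) powr (b + 1) * m u"])
  show "continuous_on {0..1} (\<lambda>u. u powr (a + 1) * (1 - u) powr (b + 1) * m u)"
    using assms(1,2)
    by (intro continuous_on_mult continuous_on_powr' continuous_intros DERIV_continuous_on[OF has_field_derivative_at_within[OF m]]) auto
  fix u :: real assume u: "0 < u" "u < 1"
  have 1: "((\<lambda>u. u powr (a + 1)) has_real_derivative u powr (a + 1) * ((a + 1) * 1 / u)) (at u)"
    "((\<lambda>u. (1 - u) powr (b + 1)) has_real_derivative (1 - u) powr (b + 1) * ((b + 1) * - 1 / (1 - u))) (at u)"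
    by (rule has_real_derivative_powr_base; use u in \<open>auto intro!: derivative_eq_intros\<close>)+
  have e: "u powr (a + 1) = u powr a * u" "(1 - u) powr (b + 1) = (1 - u) powr b * (1 - u)"
    using u by (simp_all add: powr_add)
  show "((\<lambda>u. u powr (a + 1) * (1 - u) powr (b + 1) * m u) has_real_derivative
      ((a + 1 - (a + b + 2) * u) * m u + u * (1 - u) * m' u) * (u powr a * (1 - u) powr b)) (at u)"
  proof (rule DERIV_cong[OF DERIV_mult[OF DERIV_mult[OF 1] m]])
    \<comment> \<open>Expressing \<open>a\<close> and \<open>b\<close> through the quotients
      \<open>p\<close> and \<open>q\<close> removes all divisions.\<close>
    define A B p q where "A = u powr a" and "B = (1 - u) powr b"
      and "p = (a + 1) * 1 / u" and "q = (b + 1) * - 1 / (1 - u)"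
    have pq: "a = u * p - 1" "b = - (1 - u) * q - 1"
      using u by (simp_all add: p_def q_def field_simps)
    show "(u powr (a + 1) * ((a + 1) * 1 / u) * (1 - u) powr (b + 1)
       + (1 - u) powr (b + 1) * ((b + 1) * - 1 / (1 - u)) * u powr (a + 1)) * m u
       + m' u * (u powr (a + 1) * (1 - u) powr (b + 1)) =
      ((a + 1 - (a + b + 2) * u) * m u + u * (1 - u) * m' u) * (u powr a * (1 - u) powr b)"
      unfolding e A_def[symmetric] B_def[symmetric] p_def[symmetric] q_def[symmetric]
      unfolding pq by (simp add: algebra_simps)
  qed
qed (use int in auto)

text \<open>Here the antiderivative is
  \<open>(1 - t\<^sup>2) powr (a + 1) * t powr (b + 1) * n t\<close>. The factor \<open>t\<close>
  extracted from the angular derivative raises the exponent of \<open>t\<close> to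
  \<open>b + 1\<close>, which is positive, so the boundary term at the diagonal \<open>t = 0\<close>
  vanishes.\<close>

lemma integral_angular_eq_0:
  fixes a b :: real and n n' :: "real \<Rightarrow> real"
  assumes "a > -1" "b > -1" and n: "\<And>t. (n has_real_derivative n' t) (at t)"
    and int: "set_integrable lborel {0<..<1}
      (\<lambda>t. (((b + 1) * (1 - t\<^sup>2) - 2 * (a + 1) * t\<^sup>2) * n t + (1 - t\<^sup>2) * t * n' t) * ((1 - t\<^sup>2) powr a * t powr b))"
  shows "(LINT t:{0<..<1}|lborel.
      (((b + 1) * (1 - t\<^sup>2) - 2 * (a + 1) * t\<^sup>2) * n t + (1 - t\<^sup>2) * t * n' t) * ((1 - t\<^sup>2) powr a * t powr b)) = 0"
proof (rule integral_derivative_eq_0[where h = "\<lambda>t. (1 - t\<^sup>2) powr (a + 1) * t powr (b + 1) * n t"])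
  show "continuous_on {0..1} (\<lambda>t. (1 - t\<^sup>2) powr (a + 1) * t powr (b + 1) * n t)"
    using assms(1,2)
    by (intro continuous_on_mult continuous_on_powr' continuous_intros DERIV_continuous_on[OF has_field_derivative_at_within[OF n]])
       (auto simp: power_le_one)
  fix t :: real assume t: "0 < t" "t < 1"
  have t2: "1 - t\<^sup>2 > 0" using t by (simp add: power_less_one_iff)
  have 1: "((\<lambda>t. (1 - t\<^sup>2) powr (a + 1)) has_real_derivative (1 - t\<^sup>2) powr (a + 1) * ((a + 1) * (- 2 * t) / (1 - t\<^sup>2))) (at t)"
    "((\<lambda>t. t powr (b + 1)) has_real_derivative t powr (b + 1) * ((b + 1) * 1 / t)) (at t)"
    by (rule has_real_derivative_powr_base; use t t2 in \<open>auto intro!: derivative_eq_intros\<close>)+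
  have e: "t powr (b + 1) = t powr b * t" "(1 - t\<^sup>2) powr (a + 1) = (1 - t\<^sup>2) powr a * (1 - t\<^sup>2)"
    using t t2 by (simp_all add: powr_add)
  show "((\<lambda>t. (1 - t\<^sup>2) powr (a + 1) * t powr (b + 1) * n t) has_real_derivative
      (((b + 1) * (1 - t\<^sup>2) - 2 * (a + 1) * t\<^sup>2) * n t + (1 - t\<^sup>2) * t * n' t) * ((1 - t\<^sup>2) powr a * t powr b)) (at t)"
  proof (rule DERIV_cong[OF DERIV_mult[OF DERIV_mult[OF 1] n]])
    define A B p q where "A = (1 - t\<^sup>2) powr a" and "B = t powr b"
      and "p = (b + 1) * 1 / t" and "q = (a + 1) * (- 2 * t) / (1 - t\<^sup>2)"
    have p: "b = t * p - 1"
      using t by (simp add: p_def)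
    have "(1 - t\<^sup>2) * q = (a + 1) * (- 2 * t)"
      using t2 by (simp add: q_def)
    then have q: "2 * (a + 1) * t\<^sup>2 = - ((1 - t\<^sup>2) * q * t)"
      by (simp add: power2_eq_square)
    show "((1 - t\<^sup>2) powr (a + 1) * ((a + 1) * (- 2 * t) / (1 - t\<^sup>2)) * t powr (b + 1)
       + t powr (b + 1) * ((b + 1) * 1 / t) * (1 - t\<^sup>2) powr (a + 1)) * n t
       + n' t * ((1 - t\<^sup>2) powr (a + 1) * t powr (b + 1)) =
      (((b + 1) * (1 - t\<^sup>2) - 2 * (a + 1) * t\<^sup>2) * n t + (1 - t\<^sup>2) * t * n' t) * ((1 - t\<^sup>2) powr a * t powr b)"
      unfolding e A_def[symmetric] B_def[symmetric] p_def[symmetric] q_def[symmetric] q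
      unfolding p by (simp add: algebra_simps power2_eq_square)
  qed
qed (use int in auto)

section \<open>Self-adjointness on the unit square\<close>

text \<open>The weight times the Jacobian, up to a constant. The exponent of \<open>u\<close>
  collects \<open>2 * \<alpha>\<close> from \<open>x * y\<close>, \<open>2 * \<kappa> + 1\<close>
  from \<open>x - y\<close>, and 1 from the Jacobian.\<close>

definition polar_weight :: "real \<Rightarrow> real \<Rightarrow> real \<Rightarrow> real \<times> real \<Rightarrow> real" where
  "polar_weight \<alpha> \<gamma> \<kappa> = (\<lambda>(u, t).
     (u powr (2 * \<alpha> + 2 * \<kappa> + 2) * (1 - u) powr \<gamma>) * ((1 - t\<^sup>2) powr \<alpha> * t powr (2 * \<kappa> + 1)))"

text \<open>The difference of the two integrands is the sum of a radial and an angular divergence of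
  Wronskian type. Each is a polynomial times the weight, hence integrable by itself, and is
  integrated first along its own variable.\<close>

lemma D1_symmetric_on_square:
  fixes \<alpha> \<gamma> \<kappa> :: real
  assumes par: "\<alpha> > -1" "\<gamma> > -1" "\<kappa> > -1" "\<alpha> + \<kappa> > -3/2"
    and f: "symmetric_polynomial f" and g: "symmetric_polynomial g"
  defines "I \<equiv> {0<..<1::real}"
  defines "W \<equiv> polar_weight \<alpha> \<gamma> \<kappa>"
  shows "set_integrable lborel (I \<times> I) (\<lambda>q. D1 \<alpha> \<gamma> \<kappa> f (polar q) * g (polar q) * W q)"
    and "set_integrable lborel (I \<times> I) (\<lambda>q. f (polar q) * D1 \<alpha> \<gamma> \<kappa> g (polar q) * W q)"
    and "(LINT q:I \<times> I|lborel. D1 \<alpha> \<gamma> \<kappa> f (polar q) * g (polar q) * W q) =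
         (LINT q:I \<times> I|lborel. f (polar q) * D1 \<alpha> \<gamma> \<kappa> g (polar q) * W q)"
proof -
  define a where "a = 2 * \<alpha> + 2 * \<kappa> + 2"
  define k where "k = 2 * \<kappa> + 1"
  \<comment> \<open>The bound on \<open>a\<close> is the hypothesis on
    \<open>\<alpha> + \<kappa>\<close>, the bound on \<open>k\<close> the one on \<kappa>.\<close>
  have ak: "a > -1" "k > -1" using par by (auto simp: a_def k_def)
  have pf: "real_polynomial_function f" and pg: "real_polynomial_function g"
    using f g by (auto simp: symmetric_polynomial_def)
  define rho where "rho = (\<lambda>u. u powr a * (1 - u) powr \<gamma>)"
  define tau where "tau = (\<lambda>t. (1 - t\<^sup>2) powr \<alpha> * t powr k)"
  have W: "W q = rho (fst q) * tau (snd q)" for q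
    by (simp add: W_def polar_weight_def split_def rho_def tau_def a_def k_def)
  have int: "set_integrable lborel (I \<times> I) (\<lambda>q. P q * W q)" if "real_polynomial_function P" for P
    unfolding W I_def rho_def tau_def
    by (intro set_integrable_poly_mult set_integrable_powr_Ioo set_integrable_powr_square_Ioo ak par that)
  obtain Fu Fuu K Kt where pF: "real_polynomial_function Fu" "real_polynomial_function Fuu"
    "real_polynomial_function K" "real_polynomial_function Kt"
    and Fu: "\<And>u t. ((\<lambda>s. f (polar (s, t))) has_real_derivative Fu (u, t)) (at u)"
    and Fuu: "\<And>u t. ((\<lambda>s. Fu (s, t)) has_real_derivative Fuu (u, t)) (at u)"
    and Ft: "\<And>u t. ((\<lambda>s. f (polar (u, s))) has_real_derivative u * t * K (u, t)) (at t)"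
    and Kt: "\<And>u t. ((\<lambda>s. K (u, s)) has_real_derivative Kt (u, t)) (at t)"
    and Df: "\<And>\<alpha> \<gamma> \<kappa> u t. 0 < u \<Longrightarrow> u < 1 \<Longrightarrow> 0 < t \<Longrightarrow> t < 1 \<Longrightarrow>
       D1 \<alpha> \<gamma> \<kappa> f (polar (u, t)) =
         u * (1 - u) * Fuu (u, t) + (2 * \<alpha> + 2 * \<kappa> + 3 - (2 * \<alpha> + \<gamma> + 2 * \<kappa> + 4) * u) * Fu (u, t)
         + ((2 * \<kappa> + 2) * (1 - t\<^sup>2) - 2 * (\<alpha> + 1) * t\<^sup>2) * K (u, t) + (1 - t\<^sup>2) * t * Kt (u, t)"
    by (rule D1_polar[OF f]) (rule that)
  obtain Gu Guu L Lt where pG: "real_polynomial_function Gu" "real_polynomial_function Guu"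
    "real_polynomial_function L" "real_polynomial_function Lt"
    and Gu: "\<And>u t. ((\<lambda>s. g (polar (s, t))) has_real_derivative Gu (u, t)) (at u)"
    and Guu: "\<And>u t. ((\<lambda>s. Gu (s, t)) has_real_derivative Guu (u, t)) (at u)"
    and Gt: "\<And>u t. ((\<lambda>s. g (polar (u, s))) has_real_derivative u * t * L (u, t)) (at t)"
    and Lt: "\<And>u t. ((\<lambda>s. L (u, s)) has_real_derivative Lt (u, t)) (at t)"
    and Dg: "\<And>\<alpha> \<gamma> \<kappa> u t. 0 < u \<Longrightarrow> u < 1 \<Longrightarrow> 0 < t \<Longrightarrow> t < 1 \<Longrightarrow>
       D1 \<alpha> \<gamma> \<kappa> g (polar (u, t)) =
         u * (1 - u) * Guu (u, t) + (2 * \<alpha> + 2 * \<kappa> + 3 - (2 * \<alpha> + \<gamma> + 2 * \<kappa> + 4) * u) * Gu (u, t)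
         + ((2 * \<kappa> + 2) * (1 - t\<^sup>2) - 2 * (\<alpha> + 1) * t\<^sup>2) * L (u, t) + (1 - t\<^sup>2) * t * Lt (u, t)"
    by (rule D1_polar[OF g]) (rule that)
  define op where "op = (\<lambda>Huu Hu J Jt q.
      fst q * (1 - fst q) * Huu q + (a + 1 - (a + \<gamma> + 2) * fst q) * Hu q
      + ((k + 1) * (1 - (snd q)\<^sup>2) - 2 * (\<alpha> + 1) * (snd q)\<^sup>2) * J q
      + (1 - (snd q)\<^sup>2) * snd q * (Jt q :: real))"
  have Df': "D1 \<alpha> \<gamma> \<kappa> f (polar q) = op Fuu Fu K Kt q" if "q \<in> I \<times> I" for q
    using that Df[of "fst q" "snd q"] by (cases q) (simp add: op_def I_def a_def k_def algebra_simps)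
  have Dg': "D1 \<alpha> \<gamma> \<kappa> g (polar q) = op Guu Gu L Lt q" if "q \<in> I \<times> I" for q
    using that Dg[of "fst q" "snd q"] by (cases q) (simp add: op_def I_def a_def k_def algebra_simps)
  note p = real_polynomial_function_intros pf pg pF pG
  have eqf: "set_integrable lborel (I \<times> I) (\<lambda>q. D1 \<alpha> \<gamma> \<kappa> f (polar q) * g (polar q) * W q) \<longleftrightarrow>
      set_integrable lborel (I \<times> I) (\<lambda>q. (op Fuu Fu K Kt q * g (polar q)) * W q)"
    by (intro set_integrable_cong) (simp_all add: Df')
  show intf: "set_integrable lborel (I \<times> I) (\<lambda>q. D1 \<alpha> \<gamma> \<kappa> f (polar q) * g (polar q) * W q)"
    unfolding eqf op_def by (intro int p)
  have eqg: "set_integrable lborel (I \<times> I) (\<lambda>q. f (polar q) * D1 \<alpha> \<gamma> \<kappa> g (polar q) * W q) \<longleftrightarrow>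
      set_integrable lborel (I \<times> I) (\<lambda>q. (f (polar q) * op Guu Gu L Lt q) * W q)"
    by (intro set_integrable_cong) (simp_all add: Dg')
  show intg: "set_integrable lborel (I \<times> I) (\<lambda>q. f (polar q) * D1 \<alpha> \<gamma> \<kappa> g (polar q) * W q)"
    unfolding eqg op_def by (intro int p)

  \<comment> \<open>\<open>M\<close> is the Wronskian of \<open>f\<close> and \<open>g\<close> in
    \<open>u\<close>; \<open>N\<close> below is the Wronskian in \<open>t\<close> divided by
    \<open>u * t\<close>, which keeps it polynomial.\<close>
  define M where "M = (\<lambda>q. Fu q * g (polar q) - f (polar q) * Gu q)"
  define M' where "M' = (\<lambda>q. Fuu q * g (polar q) - f (polar q) * Guu q)"
  define N where "N = (\<lambda>q. K q * g (polar q) - f (polar q) * L q)"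
  define N' where "N' = (\<lambda>q. Kt q * g (polar q) - f (polar q) * Lt q)"
  define h1 where "h1 = (\<lambda>q. (a + 1 - (a + \<gamma> + 2) * fst q) * M q + fst q * (1 - fst q) * M' q)"
  define h2 where "h2 = (\<lambda>q. ((k + 1) * (1 - (snd q)\<^sup>2) - 2 * (\<alpha> + 1) * (snd q)\<^sup>2) * N q
     + (1 - (snd q)\<^sup>2) * snd q * N' q)"
  have M: "((\<lambda>s. M (s, t)) has_real_derivative M' (u, t)) (at u)" for u t
    unfolding M_def M'_def
    by (rule DERIV_cong[OF DERIV_diff[OF DERIV_mult[OF Fuu Gu] DERIV_mult[OF Fu Guu]]]) simp
  \<comment> \<open>The mixed products are both \<open>u * t * K * L\<close> and cancel.\<close>
  have N: "((\<lambda>s. N (u, s)) has_real_derivative N' (u, t)) (at t)" for u t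
    unfolding N_def N'_def
    by (rule DERIV_cong[OF DERIV_diff[OF DERIV_mult[OF Kt Gt] DERIV_mult[OF Ft Lt]]]) (simp add: algebra_simps)
  have int1: "set_integrable lborel (I \<times> I) (\<lambda>q. h1 q * W q)"
    unfolding h1_def M_def M'_def by (intro int p)
  have int2: "set_integrable lborel (I \<times> I) (\<lambda>q. h2 q * W q)"
    unfolding h2_def N_def N'_def by (intro int p)
  have zero1: "(LINT q:I \<times> I|lborel. h1 q * W q) = 0"
  proof (rule set_integral_eq_0_fst[OF int1])
    fix t assume t: "t \<in> I" and "set_integrable lborel I (\<lambda>u. h1 (u, t) * W (u, t))"
    then have si: "set_integrable lborel I (\<lambda>u. tau t * (h1 (u, t) * rho u))"
      by (simp add: W mult_ac)
    \<comment> \<open>On this slice \<open>tau t\<close> is a nonzero constant, so it can be divided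
      out of the integrability statement.\<close>
    have "tau t \<noteq> 0"
      using t power_less_one_iff[of t 2] by (auto simp: tau_def I_def)
    with si have "set_integrable lborel I (\<lambda>u. h1 (u, t) * rho u)" by simp
    from integral_radial_eq_0[OF ak(1) par(2) M[of t], folded I_def] this
    have "(LINT u:I|lborel. h1 (u, t) * rho u) = 0"
      by (simp add: h1_def rho_def)
    then have "(LINT u:I|lborel. tau t * (h1 (u, t) * rho u)) = 0" by simp
    then show "(LINT u:I|lborel. h1 (u, t) * W (u, t)) = 0" by (simp add: W mult_ac)
  qed
  have zero2: "(LINT q:I \<times> I|lborel. h2 q * W q) = 0"
  proof (rule set_integral_eq_0_snd[OF int2])
    fix u assume u: "u \<in> I" and "set_integrable lborel I (\<lambda>t. h2 (u, t) * W (u, t))"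
    then have si: "set_integrable lborel I (\<lambda>t. rho u * (h2 (u, t) * tau t))"
      by (simp add: W mult_ac)
    have "rho u \<noteq> 0" using u by (auto simp: rho_def I_def)
    with si have "set_integrable lborel I (\<lambda>t. h2 (u, t) * tau t)" by simp
    from integral_angular_eq_0[OF par(1) ak(2) N[of u], folded I_def] this
    have "(LINT t:I|lborel. h2 (u, t) * tau t) = 0"
      by (simp add: h2_def tau_def)
    then have "(LINT t:I|lborel. rho u * (h2 (u, t) * tau t)) = 0" by simp
    then show "(LINT t:I|lborel. h2 (u, t) * W (u, t)) = 0" by (simp add: W mult_ac)
  qed
  have split: "D1 \<alpha> \<gamma> \<kappa> f (polar q) * g (polar q) * W q - f (polar q) * D1 \<alpha> \<gamma> \<kappa> g (polar q) * W q = h1 q * W q + h2 q * W q"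
    if "q \<in> I \<times> I" for q
  proof -
    have "op Fuu Fu K Kt q * g (polar q) - f (polar q) * op Guu Gu L Lt q = h1 q + h2 q"
      by (simp add: op_def h1_def h2_def M_def M'_def N_def N'_def algebra_simps)
    then show ?thesis
      unfolding Df'[OF that] Dg'[OF that] left_diff_distrib[symmetric] distrib_right[symmetric] by simp
  qed
  have sets: "I \<times> I \<in> sets lborel" by (simp add: I_def open_Times)
  have "(LINT q:I \<times> I|lborel. D1 \<alpha> \<gamma> \<kappa> f (polar q) * g (polar q) * W q)
      - (LINT q:I \<times> I|lborel. f (polar q) * D1 \<alpha> \<gamma> \<kappa> g (polar q) * W q)
      = (LINT q:I \<times> I|lborel. D1 \<alpha> \<gamma> \<kappa> f (polar q) * g (polar q) * W q - f (polar q) * D1 \<alpha> \<gamma> \<kappa> g (polar q) * W q)"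
    by (rule set_integral_diff(2)[OF intf intg, symmetric])
  also have "\<dots> = (LINT q:I \<times> I|lborel. h1 q * W q + h2 q * W q)"
    by (rule set_lebesgue_integral_cong[OF sets]) (use split in blast)
  also have "\<dots> = 0"
    by (simp only: set_integral_add(2)[OF int1 int2] zero1 zero2 add_0)
  finally show "(LINT q:I \<times> I|lborel. D1 \<alpha> \<gamma> \<kappa> f (polar q) * g (polar q) * W q) =
         (LINT q:I \<times> I|lborel. f (polar q) * D1 \<alpha> \<gamma> \<kappa> g (polar q) * W q)"
    by simp
qed

section \<open>Transfer between the triangle and the square\<close>

text \<open>In these coordinates \<open>x * y\<close> is
  \<open>u\<^sup>2 * (1 - t\<^sup>2) / 4\<close>, \<open>1 - x - y\<close> is \<open>1 - u\<close>,
  and \<open>x - y\<close> is \<open>u * t\<close>. The constant comes from the 4 and from the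
  Jacobian \<open>u / 2\<close>.\<close>

lemma weight_polar:
  fixes u t :: real
  assumes "0 < u" "u < 1" "0 < t" "t < 1"
  shows "u / 2 * weight \<alpha> \<gamma> \<kappa> (polar (u, t)) =
    (1/4) powr \<alpha> / 2 * polar_weight \<alpha> \<gamma> \<kappa> (u, t)"
proof -
  have t2: "t\<^sup>2 < 1" using assms by (simp add: power_less_one_iff)
  have "u * (1 + t) / 2 * (u * (1 - t) / 2) = (1/4) * (u * u * (1 - t\<^sup>2))"
    by (simp add: power2_eq_square field_simps)
  then have "(u * (1 + t) / 2 * (u * (1 - t) / 2)) powr \<alpha> =
      (1/4) powr \<alpha> * (u powr \<alpha> * u powr \<alpha> * (1 - t\<^sup>2) powr \<alpha>)"
    using assms t2 by (simp only: powr_mult)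
  moreover have "1 - u * (1 + t) / 2 - u * (1 - t) / 2 = 1 - u"
    by (simp add: field_simps)
  moreover have "\<bar>u * (1 + t) / 2 - u * (1 - t) / 2\<bar> = u * t"
    using assms by (simp add: field_simps)
  moreover have "(u * t) powr (2 * \<kappa> + 1) = u powr (2 * \<kappa> + 1) * t powr (2 * \<kappa> + 1)"
    using assms by (simp add: powr_mult)
  ultimately have w: "weight \<alpha> \<gamma> \<kappa> (polar (u, t)) =
      (1/4) powr \<alpha> * (u powr \<alpha> * u powr \<alpha> * (1 - t\<^sup>2) powr \<alpha>) * (1 - u) powr \<gamma>
      * (u powr (2 * \<kappa> + 1) * t powr (2 * \<kappa> + 1))"
    unfolding weight_def polar_def prod.case by (simp only:)
  have "2 * \<alpha> + 2 * \<kappa> + 2 = \<alpha> + \<alpha> + (2 * \<kappa> + 1) + 1" by simp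
  then have u: "u powr (2 * \<alpha> + 2 * \<kappa> + 2) = u powr \<alpha> * u powr \<alpha> * u powr (2 * \<kappa> + 1) * u"
    using assms(1) by (simp only: powr_add powr_one')
  show ?thesis
    unfolding w polar_weight_def prod.case u
    by (simp only: times_divide_eq_left times_divide_eq_right mult_ac)
qed

text \<open>Since \<open>0 powr a = 0\<close>, the triangle may be replaced by its interior
  pointwise, not just up to a null set.\<close>

lemma weight_lower_triangle_boundary:
  assumes "(x, y) \<in> lower_triangle" "\<not> (0 < y \<and> y < x \<and> x + y < 1)"
  shows "weight \<alpha> \<gamma> \<kappa> (x, y) = 0"
  using assms by (auto simp: lower_triangle_def simplex2_def weight_def)

text \<open>\<open>H\<close> stands for an integrand containing \<open>D1\<close>, and
  \<open>h\<close> for its Borel representative. Outside the open triangle the values of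
  \<open>H\<close> are annihilated by the indicator or by the weight.\<close>

lemma
  fixes \<alpha> \<gamma> \<kappa> :: real and h H :: "real \<times> real \<Rightarrow> real"
  assumes h: "h \<in> borel_measurable borel"
    and H: "\<And>x y. 0 < y \<Longrightarrow> y < x \<Longrightarrow> x + y < 1 \<Longrightarrow> H (x, y) = h (x, y)"
  defines "I \<equiv> {0<..<1::real}"
  defines "W \<equiv> polar_weight \<alpha> \<gamma> \<kappa>"
  shows set_integrable_lower_triangle:
      "set_integrable lborel lower_triangle (\<lambda>p. H p * weight \<alpha> \<gamma> \<kappa> p) \<longleftrightarrow>
       set_integrable lborel (I \<times> I) (\<lambda>q. H (polar q) * W q)"
    and set_integral_lower_triangle:
      "(LINT p:lower_triangle|lborel. H p * weight \<alpha> \<gamma> \<kappa> p) =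
       (1/4) powr \<alpha> / 2 * (LINT q:I \<times> I|lborel. H (polar q) * W q)"
proof -
  define T where "T = {p :: real \<times> real. 0 < snd p \<and> snd p < fst p \<and> fst p + snd p < 1}"
  define c :: real where "c = (1/4) powr \<alpha> / 2"
  define w where "w = weight \<alpha> \<gamma> \<kappa>"
  have "open T"
    unfolding T_def by (intro open_Collect_conj open_Collect_less continuous_intros)
  then have T: "T \<in> sets borel" by simp
  have w: "w = (\<lambda>p. (fst p * snd p) powr \<alpha> * (1 - fst p - snd p) powr \<gamma> * \<bar>fst p - snd p\<bar> powr (2 * \<kappa> + 1))"
    by (auto simp: w_def weight_def)
  have wm: "w \<in> borel_measurable borel" unfolding w by measurable
  have eq: "indicator lower_triangle p *\<^sub>R (H p * w p) = indicator T p * (h p * w p)" for p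
  proof (cases "p \<in> T")
    case True
    then have "p \<in> lower_triangle" "H p = h p"
      using H[of "snd p" "fst p"] by (auto simp: T_def lower_triangle_def simplex2_def split_def)
    with True show ?thesis by simp
  next
    case False
    then show ?thesis
      using weight_lower_triangle_boundary[of "fst p" "snd p"]
      by (cases "p \<in> lower_triangle") (auto simp: T_def w_def)
  qed
  have meas: "(\<lambda>p. indicator T p * (h p * w p)) \<in> borel_measurable borel"
    using T wm h by simp
  have pull: "\<bar>fst q\<bar> / 2 * (indicator T (polar q) * (h (polar q) * w (polar q))) =
      indicator (I \<times> I) q *\<^sub>R (c * (H (polar q) * W q))" for q
  proof (cases q)
    case (Pair u t)
    \<comment> \<open>\<open>polar\<close> pulls the open triangle back to exactly the open square;
      in particular no points with negative \<open>u\<close> occur.\<close>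
    have iff: "polar q \<in> T \<longleftrightarrow> q \<in> I \<times> I"
    proof
      assume "polar q \<in> T"
      then have *: "0 < u * (1 - t)" "u * t > 0" "u < 1"
        by (auto simp: T_def polar_def Pair field_simps)
      \<comment> \<open>The sum of the two positive products is \<open>u\<close>, which fixes the
        sign of \<open>u\<close> and then those of \<open>t\<close> and
        \<open>1 - t\<close>.\<close>
      from add_pos_pos[OF *(1,2)] have "0 < u" by (simp add: algebra_simps)
      with * show "q \<in> I \<times> I" by (simp add: I_def Pair zero_less_mult_iff)
    next
      assume "q \<in> I \<times> I"
      then show "polar q \<in> T"
        by (auto simp: T_def polar_def Pair I_def field_simps)
    qed
    show ?thesis
    proof (cases "q \<in> I \<times> I")
      case True
      with iff have "polar q \<in> T" by simp
      then have Hh: "H (polar q) = h (polar q)"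
        using H[of "snd (polar q)" "fst (polar q)"] by (simp add: T_def)
      have "u / 2 * w (polar q) = c * W q"
        using True weight_polar[of u t \<alpha> \<gamma> \<kappa>] by (simp add: w_def c_def W_def Pair I_def)
      have "\<bar>fst q\<bar> / 2 * (indicator T (polar q) * (h (polar q) * w (polar q))) = h (polar q) * (u / 2 * w (polar q))"
        using True \<open>polar q \<in> T\<close> by (simp add: Pair I_def)
      also have "\<dots> = indicator (I \<times> I) q *\<^sub>R (c * (H (polar q) * W q))"
        unfolding \<open>u / 2 * w (polar q) = c * W q\<close> Hh using True by simp
      finally show ?thesis .
    next
      case False
      then show ?thesis using iff by simp
    qed
  qed
  have "c \<noteq> 0" by (simp add: c_def)
  have "set_integrable lborel lower_triangle (\<lambda>p. H p * w p) \<longleftrightarrow>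
      set_integrable lborel (I \<times> I) (\<lambda>q. c * (H (polar q) * W q))"
    unfolding set_integrable_def eq integrable_polar[OF meas] pull ..
  then show "set_integrable lborel lower_triangle (\<lambda>p. H p * weight \<alpha> \<gamma> \<kappa> p) \<longleftrightarrow>
      set_integrable lborel (I \<times> I) (\<lambda>q. H (polar q) * W q)"
    using \<open>c \<noteq> 0\<close> by (simp add: w_def)
  have "(LINT p:lower_triangle|lborel. H p * w p) = (LINT q:I \<times> I|lborel. c * (H (polar q) * W q))"
    unfolding set_lebesgue_integral_def eq integral_polar[OF meas] pull ..
  then show "(LINT p:lower_triangle|lborel. H p * weight \<alpha> \<gamma> \<kappa> p) =
       (1/4) powr \<alpha> / 2 * (LINT q:I \<times> I|lborel. H (polar q) * W q)"
    by (simp add: w_def c_def)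
qed

theorem proposition4p1:
  fixes \<alpha> \<gamma> \<kappa> :: real and f g :: "real \<times> real \<Rightarrow> real"
  assumes "\<alpha> > -1" and "\<gamma> > -1" and "\<kappa> > -1" and "\<alpha> + \<kappa> > -3/2"
    and "symmetric_polynomial f" and "symmetric_polynomial g"
  shows "set_integrable lborel lower_triangle (\<lambda>p. D1 \<alpha> \<gamma> \<kappa> f p * g p * weight \<alpha> \<gamma> \<kappa> p) \<and>
         set_integrable lborel lower_triangle (\<lambda>p. f p * D1 \<alpha> \<gamma> \<kappa> g p * weight \<alpha> \<gamma> \<kappa> p) \<and>
         (LINT p:lower_triangle|lborel. D1 \<alpha> \<gamma> \<kappa> f p * g p * weight \<alpha> \<gamma> \<kappa> p)
       = (LINT p:lower_triangle|lborel. f p * D1 \<alpha> \<gamma> \<kappa> g p * weight \<alpha> \<gamma> \<kappa> p)"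
proof -
  have borel: "f \<in> borel_measurable borel" "g \<in> borel_measurable borel"
    using assms(5,6)
    by (auto simp: symmetric_polynomial_def intro!: borel_measurable_continuous_onI continuous_on_real_polynomial_function)
  obtain Ef where Ef: "Ef \<in> borel_measurable borel"
    "\<And>x y. 0 < y \<Longrightarrow> y < x \<Longrightarrow> x + y < 1 \<Longrightarrow> D1 \<alpha> \<gamma> \<kappa> f (x, y) = Ef (x, y)"
    by (rule D1_borel[OF assms(5)]) (rule that)
  obtain Eg where Eg: "Eg \<in> borel_measurable borel"
    "\<And>x y. 0 < y \<Longrightarrow> y < x \<Longrightarrow> x + y < 1 \<Longrightarrow> D1 \<alpha> \<gamma> \<kappa> g (x, y) = Eg (x, y)"
    by (rule D1_borel[OF assms(6)]) (rule that)
  have h: "(\<lambda>p. Ef p * g p) \<in> borel_measurable borel" "(\<lambda>p. f p * Eg p) \<in> borel_measurable borel"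
    using borel Ef(1) Eg(1) by simp_all
  note left = set_integrable_lower_triangle[OF h(1), of "\<lambda>p. D1 \<alpha> \<gamma> \<kappa> f p * g p"]
    set_integral_lower_triangle[OF h(1), of "\<lambda>p. D1 \<alpha> \<gamma> \<kappa> f p * g p"]
  note right = set_integrable_lower_triangle[OF h(2), of "\<lambda>p. f p * D1 \<alpha> \<gamma> \<kappa> g p"]
    set_integral_lower_triangle[OF h(2), of "\<lambda>p. f p * D1 \<alpha> \<gamma> \<kappa> g p"]
  \<comment> \<open>Both integrals acquire the same constant factor on passing to the square, so
    equality there gives equality on the triangle.\<close>
  show ?thesis
    using D1_symmetric_on_square[OF assms] by (simp add: left right Ef(2) Eg(2))
qed

end
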